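(* If a finite group $G$ has a subgroup $H$ of index $2$ and $k(G)-k(H)\ge 4$, then $G$ has a non $\mathcal{P}$-interval metric, i.e. there is an invariant metric on $G$ which is not $\mathcal{P}$-interval.
   Context: For a finite group $G$ of order $n$ with identity $e$, $k(G)=\frac12\big(n+\#\{x\in G: x^2=e\}\big)-1$. All metrics on groups are integral (integer valued) and right translation invariant: $d(gh,g'h)=d(g,g')$ for all $g,g',h\in G$. The weight of $d$ is $w(x)=d(x,e)$. The partition induced by $d$, denoted $P(G,d)$, is the set of classes of the equivalence relation $g\sim h\Leftrightarrow w(g)=w(h)$. An interval metric is such a metric $d$ with finitely many weights and without gaps: if $P(G,d)$ has $n$ parts different from $\{e\}$, then the set of values of $w$ is exactly $\{0,1,\ldots,n\}$. A metric $d$ on $G$ is $\mathcal{P}$-interval if there is an interval metric $d'$ on $G$ with $P(G,d)=P(G,d')$. *)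

theory Defs
  imports "HOL-Algebra.Coset" "HOL-Analysis.Abstract_Metric_Spaces"
begin

(* k(G) is real-valued so that the division by 2 and the subtraction are those of the formula. *)
definition k_num :: "('a, 'b) monoid_scheme \<Rightarrow> real" where
  "k_num G = (real (order G) + real (card {x \<in> carrier G. x \<otimes>\<^bsub>G\<^esub> x = \<one>\<^bsub>G\<^esub>})) / 2 - 1"

(* Only the values of d on carrier G matter; Metric_space also asks d to be nonnegative and
   symmetric elsewhere, which is no restriction, as d may be 0 off the carrier. *)
definition invariant_metric :: "('a, 'b) monoid_scheme \<Rightarrow> ('a \<Rightarrow> 'a \<Rightarrow> real) \<Rightarrow> bool" where
  "invariant_metric G d \<longleftrightarrow>
     Metric_space (carrier G) d \<and>
     (\<forall>g\<in>carrier G. \<forall>h\<in>carrier G. d g h \<in> \<int>) \<and>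
     (\<forall>g\<in>carrier G. \<forall>g'\<in>carrier G. \<forall>h\<in>carrier G.
        d (g \<otimes>\<^bsub>G\<^esub> h) (g' \<otimes>\<^bsub>G\<^esub> h) = d g g')"

definition metric_weight :: "('a, 'b) monoid_scheme \<Rightarrow> ('a \<Rightarrow> 'a \<Rightarrow> real) \<Rightarrow> 'a \<Rightarrow> real" where
  "metric_weight G d x = d x \<one>\<^bsub>G\<^esub>"

definition metric_partition :: "('a, 'b) monoid_scheme \<Rightarrow> ('a \<Rightarrow> 'a \<Rightarrow> real) \<Rightarrow> 'a set set" where
  "metric_partition G d =
     carrier G // {(g, h). g \<in> carrier G \<and> h \<in> carrier G \<and> metric_weight G d g = metric_weight G d h}"

definition interval_metric :: "('a, 'b) monoid_scheme \<Rightarrow> ('a \<Rightarrow> 'a \<Rightarrow> real) \<Rightarrow> bool" where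
  "interval_metric G d \<longleftrightarrow>
     invariant_metric G d \<and>
     finite (metric_weight G d ` carrier G) \<and>
     metric_weight G d ` carrier G = real ` {0..card (metric_partition G d - {{\<one>\<^bsub>G\<^esub>}})}"

definition P_interval :: "('a, 'b) monoid_scheme \<Rightarrow> ('a \<Rightarrow> 'a \<Rightarrow> real) \<Rightarrow> bool" where
  "P_interval G d \<longleftrightarrow> (\<exists>d'. interval_metric G d' \<and> metric_partition G d = metric_partition G d')"

end

(* Let K be the complement of H and consider the partition of G into {e}, H - {e} and the inverse
   classes {x, x^-1} of K, of which there are k(G) - k(H) \<ge> 4.  It is induced by a metric, as any
   weight with values in [N, 2N] off e is subadditive.  Suppose an interval metric induces it, and
   let t be its weight on H - {e}.  Since K K \<subseteq> H, two elements of K differ in weight by at most t,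
   and t itself is not a weight on K; as K has at least four weights, t = 1 is impossible, so the
   weight 1 is attained at some b in K, the weights on K lie in {1..t+1} - {t}, and t \<ge> 4.
   Hence the weight 2 is also attained at some c in K, and c b is an element of H - {e}
   of weight at most 3. *)
theory Submission
  imports Defs
begin

text \<open>\<open>P_interval\<close> compares partitions as sets of classes; this extracts the
  pointwise form. The class of \<open>x\<close> under \<open>u\<close> is also a class under
  \<open>v\<close>, and both \<open>x\<close> and \<open>y\<close> are tested for membership in
  it.\<close>

lemma kernel_quotient_eqD:
  assumes "A // {(g, h). g \<in> A \<and> h \<in> A \<and> u g = u h} = A // {(g, h). g \<in> A \<and> h \<in> A \<and> v g = v h}"
    and "x \<in> A" "y \<in> A"
  shows "u x = u y \<longleftrightarrow> v x = v y"
proof -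
  define U V where "U = {(g, h). g \<in> A \<and> h \<in> A \<and> u g = u h}"
    and "V = {(g, h). g \<in> A \<and> h \<in> A \<and> v g = v h}"
  have "U `` {x} \<in> A // V"
    using quotientI[OF assms(2), of U] assms(1) unfolding U_def V_def by simp
  then obtain z where z: "U `` {x} = V `` {z}"
    by (auto elim: quotientE)
  have "p \<in> A \<and> u x = u p \<longleftrightarrow> z \<in> A \<and> p \<in> A \<and> v z = v p" for p
  proof -
    have "p \<in> U `` {x} \<longleftrightarrow> p \<in> V `` {z}"
      by (simp only: z)
    then show ?thesis
      using assms(2) by (simp add: U_def V_def)
  qed
  from this[of x] this[of y] assms(2,3) show ?thesis
    by metis
qed

text \<open>Both \<open>a\<close> and \<open>inv b\<close> avoid \<open>H\<close>, so they share the
  only other coset. Hence \<open>a\<close> is some \<open>h\<close> in \<open>H\<close> times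
  \<open>inv b\<close>, and multiplying by \<open>b\<close> leaves \<open>h\<close>.\<close>

lemma (in group) mult_mem_subgroup_index_2:
  assumes "subgroup H G" "card (rcosets H) = 2"
    and "a \<in> carrier G" "b \<in> carrier G" "a \<notin> H" "b \<notin> H"
  shows "a \<otimes> b \<in> H"
proof -
  have inv_b: "inv b \<in> carrier G" "inv b \<notin> H"
    using assms(1,4,6) subgroup.m_inv_closed by fastforce+
  have *: "H #> \<one> \<in> rcosets H" "H #> a \<in> rcosets H" "H #> inv b \<in> rcosets H"
    using assms(3) inv_b by (auto simp: RCOSETS_def)
  have "H #> \<one> = H"
    using assms(1) by (simp add: subgroup.subset)
  moreover have "a \<in> H #> a" "inv b \<in> H #> inv b"
    using assms(1,3) inv_b rcos_self by auto
  ultimately have "H #> \<one> \<noteq> H #> a" "H #> \<one> \<noteq> H #> inv b"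
    using assms(5) inv_b by auto
  with * assms(2) have "H #> a = H #> inv b"
    by (auto simp: card_2_iff)
  with \<open>a \<in> H #> a\<close> obtain h where "h \<in> H" "a = h \<otimes> inv b"
    by (auto simp: r_coset_def)
  moreover have "h \<in> carrier G"
    using \<open>h \<in> H\<close> assms(1) subgroup.mem_carrier by metis
  ultimately show ?thesis
    using assms(4) by (simp add: m_assoc)
qed

text \<open>The distance of \<open>g\<close> and \<open>h\<close> is the weight of \<open>g\<close>
  times \<open>inv h\<close>. Two weights off the identity add up to at least \<open>2 * N\<close>,
  which bounds every weight; this gives the triangle inequality.\<close>

lemma (in group) invariant_metric_of_weight:
  assumes "w \<one> = 0" "\<And>x. x \<in> carrier G \<Longrightarrow> w (inv x) = w x"
    and "N > 0" "\<And>x. x \<in> carrier G \<Longrightarrow> x \<noteq> \<one> \<Longrightarrow> N \<le> w x \<and> w x \<le> 2 * N"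
  obtains d where "invariant_metric G d"
    "\<And>x. x \<in> carrier G \<Longrightarrow> metric_weight G d x = real (w x)"
proof
  \<comment> \<open>\<open>Metric_space\<close> demands nonnegativity and symmetry for all
    arguments; the value 0 off the carrier secures both.\<close>
  let ?d = "\<lambda>g h. if g \<in> carrier G \<and> h \<in> carrier G then real (w (g \<otimes> inv h)) else 0"
  have eq_one: "g \<otimes> inv h = \<one> \<longleftrightarrow> g = h" if "g \<in> carrier G" "h \<in> carrier G" for g h
    using that by (auto dest: inv_equality)
  have sym: "w (g \<otimes> inv h) = w (h \<otimes> inv g)" if "g \<in> carrier G" "h \<in> carrier G" for g h
    using that assms(2)[of "g \<otimes> inv h"] by (simp add: inv_mult_group)
  have zero: "w x = 0 \<longleftrightarrow> x = \<one>" if "x \<in> carrier G" for x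
    using assms(1,3) assms(4)[OF that] by (cases "x = \<one>") auto
  have tri: "w (x \<otimes> y) \<le> w x + w y" if "x \<in> carrier G" "y \<in> carrier G" for x y
  proof (cases "x = \<one> \<or> y = \<one> \<or> x \<otimes> y = \<one>")
    case True
    then show ?thesis using that assms(1) by auto
  next
    case False
    then show ?thesis
      using assms(4)[of x] assms(4)[of y] assms(4)[of "x \<otimes> y"] that by auto
  qed
  have cancel: "inv x \<otimes> (x \<otimes> y) = y" if "x \<in> carrier G" "y \<in> carrier G" for x y
    using that by (simp flip: m_assoc)
  have "Metric_space (carrier G) ?d"
  proof
    show "0 \<le> ?d x y" for x y
      by simp
    show "?d x y = ?d y x" for x y
      using sym[of x y] by simp
    show "?d x y = 0 \<longleftrightarrow> x = y" if "x \<in> carrier G" "y \<in> carrier G" for x y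
      using that zero[of "x \<otimes> inv y"] eq_one[of x y] by simp
  next
    fix x y z assume "x \<in> carrier G" "y \<in> carrier G" "z \<in> carrier G"
    moreover from this have "(x \<otimes> inv y) \<otimes> (y \<otimes> inv z) = x \<otimes> inv z"
      by (simp add: m_assoc cancel)
    ultimately show "?d x z \<le> ?d x y + ?d y z"
      using tri[of "x \<otimes> inv y" "y \<otimes> inv z"] by simp
  qed
  moreover have "(g \<otimes> h) \<otimes> inv (g' \<otimes> h) = g \<otimes> inv g'"
    if "g \<in> carrier G" "g' \<in> carrier G" "h \<in> carrier G" for g g' h
    using that cancel[of "inv h" "inv g'"] by (simp add: inv_mult_group m_assoc)
  ultimately show "invariant_metric G ?d"
    by (simp add: invariant_metric_def)
  show "metric_weight G ?d x = real (w x)" if "x \<in> carrier G" for x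
    using that by (simp add: metric_weight_def)
qed

lemma (in group) invariant_metric_weight:
  assumes "invariant_metric G d"
  shows metric_weight_eq_0_iff: "x \<in> carrier G \<Longrightarrow> metric_weight G d x = 0 \<longleftrightarrow> x = \<one>"
    and metric_weight_inv: "x \<in> carrier G \<Longrightarrow> metric_weight G d (inv x) = metric_weight G d x"
    and metric_weight_mult_le: "x \<in> carrier G \<Longrightarrow> y \<in> carrier G \<Longrightarrow>
          metric_weight G d (x \<otimes> y) \<le> metric_weight G d x + metric_weight G d y"
proof -
  interpret Metric_space "carrier G" d
    using assms by (simp add: invariant_metric_def)
  have shift: "d (g \<otimes> h) (g' \<otimes> h) = d g g'"
    if "g \<in> carrier G" "g' \<in> carrier G" "h \<in> carrier G" for g g' h
    using assms that unfolding invariant_metric_def by blast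
  show "metric_weight G d x = 0 \<longleftrightarrow> x = \<one>" if "x \<in> carrier G"
    using that zero by (simp add: metric_weight_def)
  show "metric_weight G d (inv x) = metric_weight G d x" if "x \<in> carrier G"
    using that shift[of "inv x" \<one> x] commute[of x \<one>] by (simp add: metric_weight_def)
  show "metric_weight G d (x \<otimes> y) \<le> metric_weight G d x + metric_weight G d y"
    if "x \<in> carrier G" "y \<in> carrier G"
    using that shift[of x \<one> y] triangle[of "x \<otimes> y" y \<one>] by (simp add: metric_weight_def)
qed

text \<open>A class \<open>{x, x\<inverse>}\<close> contributes 2 to the left-hand side, whether or not \<open>x\<close> is an involution.\<close>

lemma (in group) card_plus_involutions_le:
  assumes "K \<subseteq> carrier G" "finite K"
    and "\<And>x y. x \<in> K \<Longrightarrow> y \<in> K \<Longrightarrow> w x = w y \<Longrightarrow> y = x \<or> y = inv x"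
  shows "card K + card {x \<in> K. x \<otimes> x = \<one>} \<le> 2 * card (w ` K)"
proof -
  let ?I = "{x \<in> K. x \<otimes> x = \<one>}"
  have fibre: "card {x \<in> K. w x = v} + card {x \<in> ?I. w x = v} \<le> 2" if v: "v \<in> w ` K" for v
  proof -
    obtain x where x: "x \<in> K" "w x = v" using v by auto
    have xG: "x \<in> carrier G" using x assms(1) by auto
    have sub: "{y \<in> K. w y = v} \<subseteq> {x, inv x}"
    proof
      fix y assume "y \<in> {y \<in> K. w y = v}"
      then show "y \<in> {x, inv x}"
        using assms(3)[OF x(1), of y] x(2) by simp
    qed
    show ?thesis
    proof (cases "x \<otimes> x = \<one>")
      case True
      then have "inv x = x" using xG inv_equality by blast
      then have "{y \<in> K. w y = v} \<subseteq> {x}" "{y \<in> ?I. w y = v} \<subseteq> {x}" using sub by auto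
      from this[THEN card_mono[rotated]]
      have "card {y \<in> K. w y = v} \<le> 1" "card {y \<in> ?I. w y = v} \<le> 1"
        by simp_all
      then show ?thesis by simp
    next
      case False
      \<comment> \<open>The fibre may now be a full pair, but neither member is an involution, so
        the second summand vanishes.\<close>
      then have "inv x \<otimes> inv x \<noteq> \<one>"
        using xG inv_mult_group[of x x] by (metis inv_inv inv_one m_closed)
      then have none: "{y \<in> ?I. w y = v} = {}" using sub False by auto
      have "card {y \<in> K. w y = v} \<le> card {x, inv x}"
        using sub by (intro card_mono) auto
      also have "\<dots> \<le> 2" by (simp add: card_insert_if)
      finally show ?thesis by (simp only: none card.empty)
    qed
  qed
  \<comment> \<open>Both counts are split over all weights taken on \<open>K\<close>, so that the
    sums merge termwise; a weight that no involution takes adds 0 to the second.\<close>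
  have "card K + card ?I = (\<Sum>v\<in>w ` K. card {x \<in> K. w x = v}) + (\<Sum>v\<in>w ` K. card {x \<in> ?I. w x = v})"
    using assms(2) sum.group[of K "w ` K" w "\<lambda>_. 1 :: nat"] sum.group[of ?I "w ` K" w "\<lambda>_. 1 :: nat"]
    by (simp add: image_mono)
  also have "\<dots> = (\<Sum>v\<in>w ` K. card {x \<in> K. w x = v} + card {x \<in> ?I. w x = v})"
    by (simp add: sum.distrib)
  also have "\<dots> \<le> (\<Sum>v\<in>w ` K. 2)"
    using fibre by (intro sum_mono)
  finally show ?thesis by simp
qed

text \<open>The assumptions on \<open>d\<close> speak only of which weights coincide, so they
  transfer between metrics with the same partition. Index 2 enters through
  \<open>mult\<close>.\<close>

lemma (in group) not_interval_metric:
  assumes "subgroup H G" "interval_metric G d"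
    and mult: "\<And>a b. a \<in> carrier G - H \<Longrightarrow> b \<in> carrier G - H \<Longrightarrow> a \<otimes> b \<in> H"
    and const: "\<And>x y. x \<in> H - {\<one>} \<Longrightarrow> y \<in> H - {\<one>} \<Longrightarrow> metric_weight G d x = metric_weight G d y"
    and sep: "\<And>x y. x \<in> H - {\<one>} \<Longrightarrow> y \<in> carrier G - H \<Longrightarrow> metric_weight G d x \<noteq> metric_weight G d y"
    and many: "card (metric_weight G d ` (carrier G - H)) \<ge> 4"
  shows False
proof -
  let ?K = "carrier G - H"
  \<comment> \<open>All weights on the carrier are natural numbers, so rounding loses nothing
    there.\<close>
  define w where "w x = nat \<lfloor>metric_weight G d x\<rfloor>" for x
  obtain n :: nat where range: "metric_weight G d ` carrier G = real ` {0..n}"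
    using assms(2) unfolding interval_metric_def by blast
  have inv_d: "invariant_metric G d"
    using assms(2) by (simp add: interval_metric_def)
  have w: "metric_weight G d x = real (w x)" if "x \<in> carrier G" for x
  proof -
    have "metric_weight G d x \<in> real ` {0..n}" using that range by blast
    then show ?thesis by (auto simp: w_def)
  qed
  \<comment> \<open>This is the absence of gaps: the weights form an initial segment of the
    naturals.\<close>
  have attained: "\<exists>z\<in>carrier G. w z = v" if "x \<in> carrier G" "v \<le> w x" for v x
  proof -
    have "real (w x) \<in> real ` {0..n}" using that(1) range w by (metis imageI)
    then have "real v \<in> metric_weight G d ` carrier G" using that range by auto
    then show ?thesis using w by auto
  qed
  have zero: "w x = 0 \<longleftrightarrow> x = \<one>" if "x \<in> carrier G" for x
    using metric_weight_eq_0_iff[OF inv_d that] w[OF that] by simp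
  have w_inv: "w (inv x) = w x" if "x \<in> carrier G" for x
    using metric_weight_inv[OF inv_d that] by (simp add: w_def)
  have w_mult: "w (x \<otimes> y) \<le> w x + w y" if "x \<in> carrier G" "y \<in> carrier G" for x y
    using metric_weight_mult_le[OF inv_d that] w that by simp
  have HG: "H \<subseteq> carrier G" using assms(1) subgroup.subset by blast
  have one: "\<one> \<in> H" using assms(1) subgroup.one_closed by blast
  have inv_K: "inv x \<in> ?K" if "x \<in> ?K" for x
    using that assms(1) subgroup.m_inv_closed by fastforce
  have "metric_weight G d ` ?K = real ` w ` ?K"
    unfolding image_image using w by (intro image_cong) auto
  with many have card_w: "card (w ` ?K) \<ge> 4"
    by (simp add: card_image)
  have diff: "y \<otimes> inv x \<in> H - {\<one>}" if "x \<in> ?K" "y \<in> ?K" "w x \<noteq> w y" for x y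
    using that mult[of y "inv x"] inv_K[of x] by (auto dest: inv_equality)
  \<comment> \<open>Two elements of \<open>?K\<close> with different weights yield, by
    \<open>diff\<close>, a nontrivial element of \<open>H\<close>, whose weight will be
    \<open>t\<close>.\<close>
  have "?K \<noteq> {}"
    using card_w by (intro notI) simp
  then obtain x where "x \<in> ?K" by blast
  have "\<not> w ` ?K \<subseteq> {w x}"
  proof
    assume "w ` ?K \<subseteq> {w x}"
    then have "card (w ` ?K) \<le> card {w x}"
      by (intro card_mono) simp_all
    with card_w show False by simp
  qed
  then obtain y where "y \<in> ?K" "w x \<noteq> w y"
    by (metis image_subsetI insertI1)
  with diff \<open>x \<in> ?K\<close> obtain h where h: "h \<in> H - {\<one>}" by blast
  then have hG: "h \<in> carrier G" using HG by auto
  define t where "t = w h"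
  have t: "w z = t" if "z \<in> H - {\<one>}" for z
    using const[OF that h] w hG that HG by (auto simp: t_def)
  have K_t: "w z \<noteq> t" if "z \<in> ?K" for z
    using sep[OF h that] w hG that by (auto simp: t_def)
  have pos: "w z \<ge> 1" if "z \<in> ?K" for z
    using zero[of z] that one by auto
  \<comment> \<open>Write \<open>y\<close> as \<open>y\<close> times \<open>inv x\<close> times
    \<open>x\<close>; by \<open>diff\<close> the product of the first two factors has weight
    \<open>t\<close>.\<close>
  have spread: "w y \<le> w x + t" if "x \<in> ?K" "y \<in> ?K" for x y
  proof (cases "w x = w y")
    case False
    have "w y = w ((y \<otimes> inv x) \<otimes> x)"
      using that by (simp add: m_assoc)
    also have "\<dots> \<le> w (y \<otimes> inv x) + w x"
      using that by (intro w_mult) auto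
    finally show ?thesis using t[OF diff[OF that False]] by simp
  qed simp
  have "t \<ge> 1" using zero[OF hG] h by (simp add: t_def)
  have "t \<noteq> 1"
  proof
    assume "t = 1"
    \<comment> \<open>Starting from the least weight on \<open>?K\<close>, \<open>spread\<close>
      leaves room for only two values.\<close>
    obtain x where x: "x \<in> ?K" "\<And>y. y \<in> ?K \<Longrightarrow> w x \<le> w y"
      using ex_has_least_nat[of "\<lambda>x. x \<in> ?K" x w] \<open>x \<in> ?K\<close> by metis
    have "w ` ?K \<subseteq> {w x..w x + 1}"
      using x spread \<open>t = 1\<close> by auto
    then show False
      using card_mono[of "{w x..w x + 1}" "w ` ?K"] card_w by simp
  qed
  \<comment> \<open>Such a weight is attained somewhere, but on \<open>H\<close> only 0 and
    \<open>t\<close> occur.\<close>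
  have in_K: "\<exists>z\<in>?K. w z = v" if "1 \<le> v" "v < t" for v
  proof -
    obtain z where z: "z \<in> carrier G" "w z = v"
      using attained[OF hG, of v] \<open>v < t\<close> by (auto simp: t_def)
    then have "z \<notin> H"
      using zero[of z] t[of z] that by auto
    with z show ?thesis by blast
  qed
  obtain b where b: "b \<in> ?K" "w b = 1"
    using in_K[of 1] \<open>t \<ge> 1\<close> \<open>t \<noteq> 1\<close> by auto
  \<comment> \<open>Comparison with \<open>b\<close> gives the upper bound \<open>t + 1\<close>.
    Without \<open>t\<close> itself, exactly \<open>t\<close> values remain for at least four
    weights.\<close>
  have "w ` ?K \<subseteq> {1..t + 1} - {t}"
    using spread[OF b(1)] b(2) pos K_t by fastforce
  then have "card (w ` ?K) \<le> card ({1..t + 1} - {t})"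
    by (intro card_mono) auto
  with card_w \<open>t \<ge> 1\<close> have "t \<ge> 4"
    by simp
  then obtain c where c: "c \<in> ?K" "w c = 2"
    using in_K[of 2] by auto
  \<comment> \<open>Taking \<open>inv b\<close>, also of weight 1, in \<open>diff\<close> turns the
    quotient into the product \<open>c b\<close>, so \<open>t\<close> is at most 3.\<close>
  have "c \<otimes> inv (inv b) \<in> H - {\<one>}"
    using b c inv_K w_inv by (intro diff) auto
  then have "t \<le> w c + w b"
    using t[of "c \<otimes> b"] w_mult[of c b] b c by simp
  with \<open>t \<ge> 4\<close> b c show False by simp
qed

theorem theorem2p12:
  fixes G :: "('a, 'b) monoid_scheme" and H :: "'a set"
  assumes "group G" and "finite (carrier G)"
    and "subgroup H G" and "card (rcosets\<^bsub>G\<^esub> H) = 2"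
    and "k_num G - k_num (G\<lparr>carrier := H\<rparr>) \<ge> 4"
  shows "\<exists>d. invariant_metric G d \<and> \<not> P_interval G d"
proof -
  interpret group G by fact
  let ?K = "carrier G - H"
  have HG: "H \<subseteq> carrier G" using assms(3) subgroup.subset by blast
  have one: "\<one>\<^bsub>G\<^esub> \<in> H" using assms(3) subgroup.one_closed by blast
  have inv_H: "inv\<^bsub>G\<^esub> x \<in> H \<longleftrightarrow> x \<in> H" if "x \<in> carrier G" for x
    using that assms(3) subgroup.m_inv_closed by fastforce

  obtain f :: "'a \<Rightarrow> nat" where f: "bij_betw f (carrier G) {0..<card (carrier G)}"
    using assms(2) ex_bij_betw_finite_nat by blast
  define N where "N = card (carrier G)"
  \<comment> \<open>The smaller of the two indices serves as a label below \<open>N\<close> for an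
    inverse pair.\<close>
  define c where "c x = min (f x) (f (inv\<^bsub>G\<^esub> x))" for x
  \<comment> \<open>The offset \<open>N + 1\<close> keeps the weights on \<open>?K\<close> apart
    from \<open>N\<close>, and since \<open>c x\<close> is at most \<open>N - 1\<close> they do not
    exceed \<open>2 * N\<close>.\<close>
  define W where "W x = (if x = \<one>\<^bsub>G\<^esub> then 0 else if x \<in> H then N else N + 1 + c x)" for x
  have f_less: "f x < N" if "x \<in> carrier G" for x
    using f that by (auto simp: bij_betw_def N_def)
  have f_inj: "f x = f y \<longleftrightarrow> x = y" if "x \<in> carrier G" "y \<in> carrier G" for x y
    using f that by (auto simp: bij_betw_def inj_on_def)
  have c_less: "c x < N" if "x \<in> carrier G" for x
    using f_less[OF that] by (simp add: c_def)
  have c_inv: "c (inv\<^bsub>G\<^esub> x) = c x" if "x \<in> carrier G" for x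
    using that by (simp add: c_def min.commute)
  have c_eqD: "y = x \<or> y = inv\<^bsub>G\<^esub> x" if "x \<in> carrier G" "y \<in> carrier G" "c x = c y" for x y
  proof -
    have "c x \<in> {f x, f (inv\<^bsub>G\<^esub> x)}" "c y \<in> {f y, f (inv\<^bsub>G\<^esub> y)}"
      by (auto simp: c_def min_def)
    with that f_inj have "x = y \<or> x = inv\<^bsub>G\<^esub> y \<or> inv\<^bsub>G\<^esub> x = y \<or> inv\<^bsub>G\<^esub> x = inv\<^bsub>G\<^esub> y"
      by (metis empty_iff insertE inv_closed)
    with that show ?thesis
      by (metis inv_inv)
  qed
  have "N > 0" using f_less[of "\<one>\<^bsub>G\<^esub>"] by simp
  obtain d where d: "invariant_metric G d"
    and weight: "\<And>x. x \<in> carrier G \<Longrightarrow> metric_weight G d x = real (W x)"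
  proof (rule invariant_metric_of_weight[of W N])
    show "W (inv\<^bsub>G\<^esub> x) = W x" if "x \<in> carrier G" for x
      using that by (simp add: W_def inv_H c_inv)
    show "N \<le> W x \<and> W x \<le> 2 * N" if "x \<in> carrier G" "x \<noteq> \<one>\<^bsub>G\<^esub>" for x
      using that c_less[OF that(1)] by (simp add: W_def)
  qed (use \<open>N > 0\<close> in \<open>auto simp: W_def\<close>)

  have "\<not> P_interval G d"
  proof
    assume "P_interval G d"
    then obtain d' where d': "interval_metric G d'" "metric_partition G d = metric_partition G d'"
      by (auto simp: P_interval_def)
    have ker: "metric_weight G d' x = metric_weight G d' y \<longleftrightarrow> W x = W y"
      if "x \<in> carrier G" "y \<in> carrier G" for x y
      using kernel_quotient_eqD[OF d'(2)[unfolded metric_partition_def] that] weight that by simp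
    have "card ?K + card {x \<in> ?K. x \<otimes>\<^bsub>G\<^esub> x = \<one>\<^bsub>G\<^esub>} \<le> 2 * card (metric_weight G d' ` ?K)"
    proof (rule card_plus_involutions_le)
      show "y = x \<or> y = inv\<^bsub>G\<^esub> x"
        if "x \<in> ?K" "y \<in> ?K" "metric_weight G d' x = metric_weight G d' y" for x y
        using that ker one by (intro c_eqD) (auto simp: W_def split: if_splits)
    qed (use assms(2) in auto)
    \<comment> \<open>In the difference of the two values of \<open>k_num\<close> the summands -1
      cancel and the counts over \<open>H\<close> drop out; doubling turns 4 into 8.\<close>
    moreover have "card ?K + card {x \<in> ?K. x \<otimes>\<^bsub>G\<^esub> x = \<one>\<^bsub>G\<^esub>} \<ge> 8"
    proof -
      let ?I = "\<lambda>A. {x \<in> A. x \<otimes>\<^bsub>G\<^esub> x = \<one>\<^bsub>G\<^esub>}"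
      have split: "card A = card (A \<inter> H) + card (A - H)" if "A \<subseteq> carrier G" for A
        using that assms(2) finite_subset by (metis card_Int_Diff)
      have "?I (carrier G) \<inter> H = ?I H" "?I (carrier G) - H = ?I ?K" "carrier G \<inter> H = H"
        using HG by auto
      then have "card (?I (carrier G)) = card (?I H) + card (?I ?K)"
        "card (carrier G) = card H + card ?K"
        using split[of "carrier G"] split[of "?I (carrier G)"] by auto
      with assms(5) show ?thesis
        by (simp add: k_num_def order_def field_simps)
    qed
    ultimately have "card (metric_weight G d' ` ?K) \<ge> 4"
      by linarith
    \<comment> \<open>Through \<open>ker\<close> the remaining conditions are read off
      \<open>W\<close>: it is constantly \<open>N\<close> on \<open>H\<close> without the identity
      and larger than \<open>N\<close> on \<open>?K\<close>.\<close>
    then show False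
      using assms(3,4) d'(1) HG one
      by (intro not_interval_metric[of H d'])
        (auto simp: ker W_def subset_iff intro!: mult_mem_subgroup_index_2)
  qed
  with d show ?thesis by blast
qed

end
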